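(* Let $D=(V,A)$ be a digraph (parallel arcs allowed) and let $\mathcal{L}\subseteq 2^V$ be a laminar family with $V\in\mathcal{L}$. Then \[\gamma(D,\mathcal{L})=\min_{F\in\mathcal{L}}\Theta_{F,D,\mathcal{L}}.\] That is, the minimum number of arcs whose deletion from $D$ leaves a digraph containing no $\mathcal{L}$-tight arborescence equals the minimum cardinality of an $\mathcal{L}$-double cut.
   Context: A (spanning) arborescence of $D=(V,A)$ is a set $B\subseteq A$ which is a spanning tree in the undirected sense and in which every node has in-degree at most one; the unique node of in-degree $0$ is its root. For a laminar family $\mathcal{L}\subseteq 2^V$, a spanning arborescence $B$ is $\mathcal{L}$-tight if $|\delta^{in}_B(F)|\le 1$ for all $F\in\mathcal{L}$, and $|\delta^{in}_B(F)|=0$ for all $F\in\mathcal{L}$ containing the root of $B$. Define $\gamma(D,\mathcal{L})=\min\{|H|: H\subseteq A,\ D-H \text{ contains no } \mathcal{L}\text{-tight arborescence}\}$. For $F\subseteq V$, $D[F]$ is the subdigraph induced by $F$, and $\mathcal{L}[F]=\{F'\in\mathcal{L}: F'\subseteq F\}$. For $Z\subseteq V$, let $\mathcal{L}_Z=\{F\in\mathcal{L}: F\cap Z\neq\emptyset\}$, $M_{D,\mathcal{L}}(Z)=\delta^{in}_D(Z)\setminus\bigcup_{F\in\mathcal{L}_Z}\delta^{out}_D(F)$ (the arcs entering $Z$ that leave no member of $\mathcal{L}$ meeting $Z$), and $f_{D,\mathcal{L}}(Z)=|M_{D,\mathcal{L}}(Z)|$. For $F\in\mathcal{L}$, $\Theta_{F,D,\mathcal{L}}=\min\{f_{D[F],\mathcal{L}[F]}(Z_1)+f_{D[F],\mathcal{L}[F]}(Z_2):\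 \emptyset\neq Z_1,Z_2\subseteq F,\ Z_1\cap Z_2=\emptyset\}$, with the convention $\min\emptyset=+\infty$; a set $M_{D[F],\mathcal{L}[F]}(Z_1)\cup M_{D[F],\mathcal{L}[F]}(Z_2)$ for such $F,Z_1,Z_2$ is called an $\mathcal{L}$-double cut. *)

theory Defs
  imports "Graph_Theory.Digraph_Component" "HOL-Library.Extended_Nat"
begin

text \<open>
  A digraph \<open>G\<close> with parallel arcs is a \<^typ>\<open>('a, 'b) pre_digraph\<close>. An arc set \<open>B\<close> is identified
  with the digraph \<open>G\<lparr>arcs := B\<rparr>\<close> on all nodes of \<open>G\<close>.
\<close>

text \<open>
  \<^const>\<open>tree\<close> and \<^const>\<open>forest\<close> only exclude directed cycles. For acyclicity in the undirected
  sense we give every arc two orientations, and a cycle may use only one of them.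
\<close>

definition both_orientations :: "('a, 'b) pre_digraph \<Rightarrow> ('a, 'b \<times> bool) pre_digraph" where
  "both_orientations G = \<lparr> verts = verts G, arcs = arcs G \<times> UNIV,
     tail = (\<lambda>(e, forward). if forward then tail G e else head G e),
     head = (\<lambda>(e, forward). if forward then head G e else tail G e) \<rparr>"

definition undirected_cycle :: "('a, 'b) pre_digraph \<Rightarrow> ('b \<times> bool) list \<Rightarrow> bool" where
  "undirected_cycle G p \<longleftrightarrow> pre_digraph.cycle (both_orientations G) p \<and> distinct (map fst p)"

text \<open>\<^const>\<open>Digraph_Component.connected\<close> is connectedness of the underlying undirected graph.\<close>

definition undirected_tree :: "('a, 'b) pre_digraph \<Rightarrow> bool" where
  "undirected_tree G \<longleftrightarrow> Digraph_Component.connected G \<and> \<not> (\<exists>p. undirected_cycle G p)"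

definition arborescence :: "('a, 'b) pre_digraph \<Rightarrow> 'b set \<Rightarrow> bool" where
  "arborescence G B \<longleftrightarrow> B \<subseteq> arcs G \<and> undirected_tree (G\<lparr>arcs := B\<rparr>) \<and>
     (\<forall>v \<in> verts G. in_degree (G\<lparr>arcs := B\<rparr>) v \<le> 1)"

definition arborescence_root :: "('a, 'b) pre_digraph \<Rightarrow> 'b set \<Rightarrow> 'a" where
  "arborescence_root G B = (THE r. r \<in> verts G \<and> in_degree (G\<lparr>arcs := B\<rparr>) r = 0)"

definition entering_arcs :: "('a, 'b) pre_digraph \<Rightarrow> 'a set \<Rightarrow> 'b set" where
  "entering_arcs G X = {e \<in> arcs G. tail G e \<notin> X \<and> head G e \<in> X}"

definition leaving_arcs :: "('a, 'b) pre_digraph \<Rightarrow> 'a set \<Rightarrow> 'b set" where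
  "leaving_arcs G X = {e \<in> arcs G. tail G e \<in> X \<and> head G e \<notin> X}"

definition laminar :: "'a set set \<Rightarrow> bool" where
  "laminar L \<longleftrightarrow> (\<forall>X \<in> L. \<forall>Y \<in> L. X \<subseteq> Y \<or> Y \<subseteq> X \<or> X \<inter> Y = {})"

definition tight_arborescence :: "('a, 'b) pre_digraph \<Rightarrow> 'a set set \<Rightarrow> 'b set \<Rightarrow> bool" where
  "tight_arborescence G L B \<longleftrightarrow> arborescence G B \<and>
     (\<forall>F \<in> L. card (entering_arcs (G\<lparr>arcs := B\<rparr>) F) \<le> 1) \<and>
     (\<forall>F \<in> L. arborescence_root G B \<in> F \<longrightarrow> card (entering_arcs (G\<lparr>arcs := B\<rparr>) F) = 0)"

text \<open>
  Minima are infima in \<^typ>\<open>enat\<close>: these are attained for nonempty sets, and the infimum of the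
  empty set is \<open>\<infinity>\<close>.
\<close>

definition blocking_number :: "('a, 'b) pre_digraph \<Rightarrow> 'a set set \<Rightarrow> enat" where
  "blocking_number G L = Inf {enat (card H) | H.
     H \<subseteq> arcs G \<and> \<not> (\<exists>B. tight_arborescence (G\<lparr>arcs := arcs G - H\<rparr>) L B)}"

definition restrict_family :: "'a set set \<Rightarrow> 'a set \<Rightarrow> 'a set set" where
  "restrict_family L F = {F' \<in> L. F' \<subseteq> F}"

definition cut_arcs :: "('a, 'b) pre_digraph \<Rightarrow> 'a set set \<Rightarrow> 'a set \<Rightarrow> 'b set" where
  "cut_arcs G L Z = entering_arcs G Z - (\<Union>F \<in> {F \<in> L. F \<inter> Z \<noteq> {}}. leaving_arcs G F)"

definition cut_size :: "('a, 'b) pre_digraph \<Rightarrow> 'a set set \<Rightarrow> 'a set \<Rightarrow> nat" where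
  "cut_size G L Z = card (cut_arcs G L Z)"

definition double_cut_value :: "('a, 'b) pre_digraph \<Rightarrow> 'a set set \<Rightarrow> 'a set \<Rightarrow> enat" where
  "double_cut_value G L F = Inf {enat (cut_size (G \<restriction> F) (restrict_family L F) Z1 +
                                       cut_size (G \<restriction> F) (restrict_family L F) Z2) | Z1 Z2.
     Z1 \<noteq> {} \<and> Z2 \<noteq> {} \<and> Z1 \<subseteq> F \<and> Z2 \<subseteq> F \<and> Z1 \<inter> Z2 = {}}"

definition double_cut :: "('a, 'b) pre_digraph \<Rightarrow> 'a set set \<Rightarrow> 'b set \<Rightarrow> bool" where
  "double_cut G L C \<longleftrightarrow> (\<exists>F \<in> L. \<exists>Z1 Z2.
     Z1 \<noteq> {} \<and> Z2 \<noteq> {} \<and> Z1 \<subseteq> F \<and> Z2 \<subseteq> F \<and> Z1 \<inter> Z2 = {} \<and>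
     C = cut_arcs (G \<restriction> F) (restrict_family L F) Z1 \<union> cut_arcs (G \<restriction> F) (restrict_family L F) Z2)"

end

theory Submission
  imports Defs
begin

text \<open>
  Deleting arcs only shrinks the sets \<open>M(Z)\<close>, so the min-max formula amounts to: a tight
  arborescence exists iff no double cut is empty. For \<open>F\<close> in the family call a nonempty
  \<open>Z \<subseteq> F\<close> unentered if \<open>M(Z)\<close>, computed in \<open>G[F]\<close>, is empty. A tight arborescence gets into
  each \<open>F\<close> at a single node, and every unentered subset of \<open>F\<close> contains it, so no two are
  disjoint. Conversely, if any two unentered subsets of each \<open>F\<close> meet, then they are closed under
  intersection and each nonempty \<open>F\<close> has a least one, its core. A tight arborescence then grows
  greedily from a node in the core of the whole node set: always complete a minimal partially
  explored member, and get into a new member only through its core.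
\<close>

section \<open>Arborescences and generation from the root\<close>

text \<open>Directed reachability of \<open>S\<close> from \<open>r\<close> along \<open>B\<close>,
  phrased through closed sets instead of walks, so that each use only has to exhibit a suitable
  closed set \<open>X\<close>.\<close>

definition generates :: "('a, 'b) pre_digraph \<Rightarrow> 'b set \<Rightarrow> 'a \<Rightarrow> 'a set \<Rightarrow> bool" where
  "generates G B r S \<longleftrightarrow>
     (\<forall>X. r \<in> X \<longrightarrow> (\<forall>e \<in> B. tail G e \<in> X \<longrightarrow> head G e \<in> X) \<longrightarrow> S \<subseteq> X)"

lemma generatesD:
  assumes "generates G B r S" "r \<in> X" "\<And>e. e \<in> B \<Longrightarrow> tail G e \<in> X \<Longrightarrow> head G e \<in> X"
  shows "S \<subseteq> X"
  using assms unfolding generates_def by blast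

lemma wf_digraph_arcs_subset:
  assumes "wf_digraph G" "B \<subseteq> arcs G"
  shows "wf_digraph (G\<lparr>arcs := B\<rparr>)"
  using assms by (auto simp: wf_digraph_def)

lemma fin_digraph_arcs_subset:
  assumes "fin_digraph G" "B \<subseteq> arcs G"
  shows "fin_digraph (G\<lparr>arcs := B\<rparr>)"
  using assms by (auto simp: wf_digraph_def fin_digraph_def fin_digraph_axioms_def intro: finite_subset)

section \<open>Closed walks and undirected cycles\<close>

lemma (in pre_digraph) cas_nth_Suc:
  "cas u p v \<Longrightarrow> Suc i < length p \<Longrightarrow> head G (p ! i) = tail G (p ! Suc i)"
proof (induction p arbitrary: u i)
  case (Cons e p)
  then show ?case by (cases p; cases i) auto
qed simp

lemma (in pre_digraph) cas_last: "cas u p v \<Longrightarrow> p \<noteq> [] \<Longrightarrow> head G (last p) = v"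
  by (induction p arbitrary: u) auto

lemma (in pre_digraph) closed_walk_nth:
  assumes "cas u p u" "i < length p"
  shows "head G (p ! i) = tail G (p ! (Suc i mod length p))"
proof (cases "Suc i < length p")
  case True
  then show ?thesis using cas_nth_Suc[OF assms(1)] by simp
next
  case False
  then have i: "Suc i = length p" using assms(2) by simp
  then have "head G (p ! i) = u"
    using cas_last[OF assms(1)] by (cases "p = []") (auto simp: last_conv_nth simp flip: i)
  moreover have "tail G (p ! 0) = u"
    using assms by (cases p) auto
  ultimately show ?thesis using i by simp
qed

text \<open>
  At a highest node of an undirected cycle, both cycle arcs would be directed into that node.
\<close>

lemma no_undirected_cycle:
  fixes h :: "'a \<Rightarrow> nat"
  assumes inj: "inj_on (head G) (arcs G)"
    and h: "\<And>e. e \<in> arcs G \<Longrightarrow> h (tail G e) < h (head G e)"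
  shows "\<not> undirected_cycle G p"
proof
  assume "undirected_cycle G p"
  then obtain u where aw: "pre_digraph.awalk (both_orientations G) u p u" and ne: "p \<noteq> []"
    and dist: "distinct (map fst p)"
    unfolding undirected_cycle_def pre_digraph.cycle_def by auto
  let ?T = "tail (both_orientations G)" and ?H = "head (both_orientations G)"
  let ?n = "length p"
  have cas: "pre_digraph.cas (both_orientations G) u p u"
    and arcs: "\<And>i. i < ?n \<Longrightarrow> fst (p ! i) \<in> arcs G"
    using aw unfolding pre_digraph.awalk_def
    by (auto simp: both_orientations_def dest!: nth_mem split: prod.splits)
  have nx: "?H (p ! i) = ?T (p ! (Suc i mod ?n))" if "i < ?n" for i
    using pre_digraph.closed_walk_nth[OF cas that] .
  have n: "0 < ?n" using ne by simp
  obtain j where j: "j < ?n" and jmax: "\<And>i. i < ?n \<Longrightarrow> h (?H (p ! i)) \<le> h (?H (p ! j))"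
  proof -
    let ?m = "Max ((\<lambda>i. h (?H (p ! i))) ` {..<?n})"
    have "?m \<in> (\<lambda>i. h (?H (p ! i))) ` {..<?n}" using n by (intro Max_in) auto
    then obtain j where "j < ?n" "h (?H (p ! j)) = ?m" by auto
    then show ?thesis by (intro that[of j]) auto
  qed
  let ?i = "Suc j mod ?n"
  have i: "?i < ?n" using n by simp
  have T: "?T (p ! ?i) = ?H (p ! j)" using nx[OF j] by simp
  have "h (?H (p ! ?i)) \<le> h (?T (p ! ?i))" using jmax[OF i] T by simp
  \<comment> \<open>Heights rise along arcs, so a traversal step that does not rise runs its arc
    backwards.\<close>
  then have a: "head G (fst (p ! ?i)) = ?T (p ! ?i)"
    using h[OF arcs[OF i]] by (auto simp: both_orientations_def split: prod.splits if_splits)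
  \<comment> \<open>The cyclic predecessor of \<open>j\<close>; adding \<open>?n\<close> first keeps
    the subtraction on naturals exact at \<open>j = 0\<close>.\<close>
  define k where "k = (j + ?n - 1) mod ?n"
  have k: "k < ?n" using n by (simp add: k_def)
  have "Suc k mod ?n = j" using n j unfolding k_def
    by (metis Suc_pred' add_gr_0 mod_Suc_eq mod_add_self2 mod_less)
  then have "?T (p ! j) = ?H (p ! k)" using nx[OF k] by simp
  then have "h (?T (p ! j)) \<le> h (?H (p ! j))" using jmax[OF k] by simp
  then have b: "head G (fst (p ! j)) = ?H (p ! j)" 
    using h[OF arcs[OF j]] by (auto simp: both_orientations_def split: prod.splits if_splits)
  \<comment> \<open>Both arcs have the highest node as head and so coincide. Distinctness then
    shrinks the cycle to a loop, which the strict growth of \<open>h\<close> forbids.\<close>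
  have "fst (p ! ?i) = fst (p ! j)"
    using inj arcs[OF i] arcs[OF j] a b T by (auto simp: inj_on_def)
  then have "?i = j" using dist i j by (simp add: distinct_conv_nth) (metis nth_map)
  then have "?T (p ! j) = ?H (p ! j)" using T by simp
  then show False using h[OF arcs[OF j]]
    by (auto simp: both_orientations_def split: prod.splits if_splits)
qed

lemma connected_if_generates:
  assumes "wf_digraph G" "r \<in> verts G" and gen: "generates G (arcs G) r (verts G)"
  shows "Digraph_Component.connected G"
proof -
  interpret wf_digraph G by fact
  interpret S: pair_wf_digraph "mk_symmetric G" ..
  have reach: "r \<rightarrow>\<^sup>*\<^bsub>mk_symmetric G\<^esub> v" if "v \<in> verts G" for v
  proof -
    have "verts G \<subseteq> {v. r \<rightarrow>\<^sup>*\<^bsub>mk_symmetric G\<^esub> v}"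
    proof (rule generatesD[OF gen])
      fix e assume "e \<in> arcs G" "tail G e \<in> {v. r \<rightarrow>\<^sup>*\<^bsub>mk_symmetric G\<^esub> v}"
      then show "head G e \<in> {v. r \<rightarrow>\<^sup>*\<^bsub>mk_symmetric G\<^esub> v}"
        by (auto simp: parcs_mk_symmetric elim!: S.reachable_adj_trans)
    qed (use assms in auto)
    then show ?thesis using that by auto
  qed
  have "v \<rightarrow>\<^sup>*\<^bsub>mk_symmetric G\<^esub> r" if "v \<in> verts G" for v
    using symmetric_reachable[OF symmetric_mk_symmetric reach[OF that]] .
  from S.reachable_trans[OF this reach] show ?thesis
    unfolding connected_def strongly_connected_def using assms(2) by auto
qed

text \<open>Injectivity of \<open>head G\<close> on \<open>B\<close> is the in-degree bound, and the
  height \<open>h\<close> certifies acyclicity in the undirected sense.\<close>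

lemma arborescenceI:
  fixes h :: "'a \<Rightarrow> nat"
  assumes G: "fin_digraph G" and B: "B \<subseteq> arcs G" and r: "r \<in> verts G"
    and inj: "inj_on (head G) B" and root: "\<And>e. e \<in> B \<Longrightarrow> head G e \<noteq> r"
    and gen: "generates G B r (verts G)"
    and h: "\<And>e. e \<in> B \<Longrightarrow> h (tail G e) < h (head G e)"
  shows "arborescence G B" and "arborescence_root G B = r"
proof -
  interpret fin_digraph G by fact
  let ?B = "G\<lparr>arcs := B\<rparr>"
  have wf: "wf_digraph ?B" using wf_digraph_arcs_subset[OF wf_digraph B] .
  have fin: "finite B" using B finite_arcs finite_subset by blast
  have in_arcs: "in_arcs ?B v = {e \<in> B. head G e = v}" for v by (auto simp: in_arcs_def)
  have "in_degree ?B v \<le> 1" for v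
    unfolding in_degree_def in_arcs using inj fin
    by (auto simp: card_le_Suc0_iff_eq inj_on_def)
  moreover have "undirected_tree ?B"
    unfolding undirected_tree_def
    using connected_if_generates[OF wf, of r] r gen no_undirected_cycle[of ?B h] inj h
    by (auto simp: generates_def)
  ultimately show "arborescence G B" using B by (simp add: arborescence_def)
  have "in_degree ?B r = 0" unfolding in_degree_def in_arcs using root fin by auto
  moreover have "v = r" if "v \<in> verts G" "in_degree ?B v = 0" for v
  proof (rule ccontr)
    assume "v \<noteq> r"
    moreover have "head G e \<noteq> v" if "e \<in> B" for e
      using that \<open>in_degree ?B v = 0\<close> fin unfolding in_degree_def in_arcs by auto
    \<comment> \<open>No arc of \<open>B\<close> has head \<open>v\<close>, so the complement of
      \<open>v\<close> is closed and \<open>v\<close> would never be generated.\<close>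
    ultimately have "verts G \<subseteq> - {v}" by (intro generatesD[OF gen]) auto
    then show False using that by auto
  qed
  ultimately show "arborescence_root G B = r"
    unfolding arborescence_root_def using r by blast
qed

text \<open>A directed cycle, traversed forward throughout, is an undirected one. So the arc
  relation is acyclic and, being finite, well-founded; a minimal node is a source.\<close>

lemma ex_source_if_no_undirected_cycle:
  assumes G: "fin_digraph G" and ne: "verts G \<noteq> {}" and nc: "\<nexists>p. undirected_cycle G p"
  shows "\<exists>r \<in> verts G. \<forall>e \<in> arcs G. head G e \<noteq> r"
proof -
  interpret fin_digraph G by fact
  have no_cycle: "\<not> cycle p" for p
  proof
    assume "cycle p"
    then obtain u where p: "awalk u p u" "distinct (tl (awalk_verts u p))" "distinct p" "p \<noteq> []"
      unfolding cycle_conv by auto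
    let ?q = "map (\<lambda>e. (e, True)) p"
    have verts: "pre_digraph.awalk_verts (both_orientations G) v (map (\<lambda>e. (e, True)) p)
        = awalk_verts v p" for v p
      by (induction p arbitrary: v) (auto simp: both_orientations_def pre_digraph.awalk_verts.simps)
    have cas: "pre_digraph.cas (both_orientations G) v (map (\<lambda>e. (e, True)) p) w
        = cas v p w" for v w p
      by (induction p arbitrary: v) (auto simp: both_orientations_def pre_digraph.cas.simps)
    have "undirected_cycle G ?q"
      unfolding undirected_cycle_def pre_digraph.cycle_def pre_digraph.awalk_def
      using p by (intro conjI exI[of _ u])
        (auto simp: verts cas awalk_def comp_def, auto simp: both_orientations_def)
    then show False using nc by blast
  qed
  have "acyclic (arcs_ends G)"
  proof (rule acyclicI, intro allI notI)
    fix v assume "v \<rightarrow>\<^sup>+\<^bsub>G\<^esub> v"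
    then obtain p where "awalk v p v" "p \<noteq> []" using reachable1_awalk by auto
    then have "closed_w p" unfolding closed_w_def by auto
    then show False using closed_w_imp_cycle no_cycle by blast
  qed
  moreover have "finite (arcs_ends G)" by (simp add: arcs_ends_def)
  ultimately have "wf (arcs_ends G)" by (rule finite_acyclic_wf[rotated])
  then obtain r where "r \<in> verts G" "\<And>y. (y, r) \<in> arcs_ends G \<Longrightarrow> y \<notin> verts G"
    using ne by (metis ex_in_conv wfE_min)
  moreover from this have "head G e \<noteq> r" if "e \<in> arcs G" for e
    using that in_arcs_imp_in_arcs_ends tail_in_verts by blast
  ultimately show ?thesis by blast
qed

text \<open>The set \<open>R\<close> reached from \<open>r\<close> is closed under following arcs in
  both directions, so connectedness makes it everything.\<close>

lemma generates_if_connected: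
  assumes G: "wf_digraph G" and con: "Digraph_Component.connected G"
    and inj: "inj_on (head G) (arcs G)"
    and r: "r \<in> verts G" "\<And>e. e \<in> arcs G \<Longrightarrow> head G e \<noteq> r"
  shows "generates G (arcs G) r (verts G)"
  unfolding generates_def
proof (intro allI impI)
  fix X assume X: "r \<in> X" "\<forall>e \<in> arcs G. tail G e \<in> X \<longrightarrow> head G e \<in> X"
  interpret wf_digraph G by fact
  interpret S: pair_wf_digraph "mk_symmetric G" ..
  define R where "R = (arcs_ends G)\<^sup>* `` {r}"
  have backward: "tail G e \<in> R" if e: "e \<in> arcs G" "head G e \<in> R" for e
  proof -
    have "(r, head G e) \<in> (arcs_ends G)\<^sup>*" using e by (simp add: R_def)
    \<comment> \<open>The head of \<open>e\<close> is not \<open>r\<close>, so a path reaching it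
      has a last arc; injectivity of \<open>head G\<close> identifies that arc with
      \<open>e\<close>.\<close>
    then obtain w where "w \<in> R" "(w, head G e) \<in> arcs_ends G"
      by (cases rule: rtranclE) (use r e in \<open>auto simp: R_def\<close>)
    moreover from this obtain e' where "e' \<in> arcs G" "tail G e' = w" "head G e' = head G e"
      by auto
    ultimately show ?thesis using inj e by (auto simp: inj_on_def)
  qed
  have forward: "head G e \<in> R" if "e \<in> arcs G" "tail G e \<in> R" for e
    using that in_arcs_imp_in_arcs_ends unfolding R_def
    by (auto intro: rtrancl_into_rtrancl)
  have RX: "R \<subseteq> X"
  proof
    fix v assume "v \<in> R"
    then have "(r, v) \<in> (arcs_ends G)\<^sup>*" by (simp add: R_def)
    then show "v \<in> X"
      by (induction rule: rtrancl_induct) (use X in auto)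
  qed
  have "v \<in> R" if "r \<rightarrow>\<^sup>*\<^bsub>mk_symmetric G\<^esub> v" for v
    using that
  proof (induction rule: S.reachable_induct)
    case base then show ?case using r by (auto simp: R_def)
  next
    case (step x y) then show ?case using backward forward by (auto simp: parcs_mk_symmetric)
  qed
  then have "verts G \<subseteq> R"
    using con r unfolding connected_def strongly_connected_def by auto
  then show "verts G \<subseteq> X" using RX by blast
qed

text \<open>Acyclicity yields a source, and generation from it shows that no other node has
  in-degree 0; this pins down the description in \<open>arborescence_root\<close>.\<close>

lemma arborescence_generates:
  assumes G: "fin_digraph G" and arb: "arborescence G B"
  shows "arborescence_root G B \<in> verts G" (is ?in)
    and "generates G B (arborescence_root G B) (verts G)" (is ?gen)
proof -
  let ?B = "G\<lparr>arcs := B\<rparr>"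
  have B: "B \<subseteq> arcs G" and tree: "undirected_tree ?B"
    and deg: "\<And>v. v \<in> verts G \<Longrightarrow> in_degree ?B v \<le> 1"
    using arb by (auto simp: arborescence_def)
  interpret fin_digraph ?B using fin_digraph_arcs_subset[OF G B] .
  have in_arcs: "in_arcs ?B v = {e \<in> B. head G e = v}" for v by (auto simp: in_arcs_def)
  have fin: "finite B" using finite_arcs by simp
  have inj: "inj_on (head G) B"
  proof (rule inj_onI)
    fix e e' assume "e \<in> B" "e' \<in> B" "head G e = head G e'"
    then show "e = e'"
      using deg[of "head G e"] head_in_verts[of e] fin unfolding in_degree_def in_arcs
      by (auto simp: card_le_Suc0_iff_eq)
  qed
  have con: "Digraph_Component.connected ?B" using tree by (simp add: undirected_tree_def)
  then have "verts ?B \<noteq> {}" unfolding connected_def strongly_connected_def by auto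
  then obtain r where r: "r \<in> verts G" "\<And>e. e \<in> B \<Longrightarrow> head G e \<noteq> r"
    using ex_source_if_no_undirected_cycle[OF fin_digraph] tree
    by (auto simp: undirected_tree_def)
  have gen: "generates G B r (verts G)"
    using generates_if_connected[OF wf_digraph con, of r] inj r by (simp add: generates_def)
  have "arborescence_root G B = r"
    unfolding arborescence_root_def
  proof (rule the_equality)
    show "r \<in> verts G \<and> in_degree ?B r = 0"
      using r fin unfolding in_degree_def in_arcs by auto
  next
    fix v assume v: "v \<in> verts G \<and> in_degree ?B v = 0"
    then have "head G e \<noteq> v" if "e \<in> B" for e
      using that fin unfolding in_degree_def in_arcs by auto
    then have "v \<noteq> r \<Longrightarrow> verts G \<subseteq> - {v}" by (intro generatesD[OF gen]) auto
    then show "v = r" using v by auto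
  qed
  then show ?in ?gen using r gen by auto
qed

section \<open>Sets that no admissible arc enters\<close>

locale laminar_digraph = fin_digraph G for G :: "('a, 'b) pre_digraph" +
  fixes L :: "'a set set"
  assumes family: "L \<subseteq> Pow (verts G)"
    and laminar: "laminar L"
    and verts_in_family: "verts G \<in> L"
begin

lemma laminarD: "X \<in> L \<Longrightarrow> Y \<in> L \<Longrightarrow> X \<subseteq> Y \<or> Y \<subseteq> X \<or> X \<inter> Y = {}"
  using laminar by (auto simp: laminar_def)

lemma finite_family: "finite L"
  using family by (rule finite_subset) simp

lemma finite_member: "F \<in> L \<Longrightarrow> finite F"
  using family finite_verts finite_subset by blast

lemma ex_minimal_member:
  assumes "F \<in> L" "P F"
  obtains F0 where "F0 \<in> L" "P F0" "\<And>F'. F' \<in> L \<Longrightarrow> P F' \<Longrightarrow> F' \<subseteq> F0 \<Longrightarrow> F' = F0"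
proof -
  have "finite {F \<in> L. P F}" "{F \<in> L. P F} \<noteq> {}" using finite_family assms by auto
  from finite_has_minimal[OF this] obtain F0 where "F0 \<in> L" "P F0"
    "\<forall>F' \<in> {F \<in> L. P F}. F' \<subseteq> F0 \<longrightarrow> F0 = F'" by blast
  then show thesis by (intro that[of F0]) auto
qed

lemma ex_maximal_member:
  assumes "F \<in> L" "P F"
  obtains F0 where "F0 \<in> L" "P F0" "F \<subseteq> F0"
    "\<And>F'. F' \<in> L \<Longrightarrow> P F' \<Longrightarrow> F0 \<subseteq> F' \<Longrightarrow> F' = F0"
proof -
  have "finite {F \<in> L. P F}" "F \<in> {F \<in> L. P F}" using finite_family assms by auto
  from finite_has_maximal2[OF this] obtain F0 where "F0 \<in> L" "P F0" "F \<subseteq> F0"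
    "\<forall>F' \<in> {F \<in> L. P F}. F0 \<subseteq> F' \<longrightarrow> F0 = F'" by blast
  then show thesis by (intro that[of F0]) auto
qed

definition unentered :: "'a set \<Rightarrow> 'a set \<Rightarrow> bool" where
  "unentered F Z \<longleftrightarrow> Z \<noteq> {} \<and> Z \<subseteq> F \<and> cut_arcs (G \<restriction> F) (restrict_family L F) Z = {}"

lemma cut_arcs_restrict_iff:
  assumes "Z \<subseteq> F"
  shows "e \<in> cut_arcs (G \<restriction> F) (restrict_family L F) Z \<longleftrightarrow>
    e \<in> arcs G \<and> tail G e \<in> F \<and> tail G e \<notin> Z \<and> head G e \<in> Z \<and>
    (\<forall>F' \<in> L. F' \<subseteq> F \<longrightarrow> F' \<inter> Z \<noteq> {} \<longrightarrow> tail G e \<in> F' \<longrightarrow> head G e \<in> F')"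
  using assms
  by (auto simp: cut_arcs_def entering_arcs_def leaving_arcs_def restrict_family_def)

lemma unenteredI:
  assumes "Z \<noteq> {}" "Z \<subseteq> F"
    and "\<And>e. e \<in> arcs G \<Longrightarrow> tail G e \<in> F \<Longrightarrow> tail G e \<notin> Z \<Longrightarrow> head G e \<in> Z \<Longrightarrow>
      \<exists>F' \<in> L. F' \<subseteq> F \<and> F' \<inter> Z \<noteq> {} \<and> tail G e \<in> F' \<and> head G e \<notin> F'"
  shows "unentered F Z"
proof -
  have "e \<notin> cut_arcs (G \<restriction> F) (restrict_family L F) Z" for e
    using assms(3)[of e] unfolding cut_arcs_restrict_iff[OF assms(2)] by blast
  then have "cut_arcs (G \<restriction> F) (restrict_family L F) Z = {}" by blast
  then show ?thesis using assms(1,2) by (simp add: unentered_def)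
qed

lemma unenteredD: "unentered F Z \<Longrightarrow> Z \<noteq> {}" "unentered F Z \<Longrightarrow> Z \<subseteq> F"
  by (auto simp: unentered_def)

lemma unentered_arcD:
  assumes "unentered F Z" "e \<in> arcs G" "tail G e \<in> F" "tail G e \<notin> Z" "head G e \<in> Z"
  shows "\<exists>F' \<in> L. F' \<subseteq> F \<and> F' \<inter> Z \<noteq> {} \<and> tail G e \<in> F' \<and> head G e \<notin> F'"
proof -
  have "Z \<subseteq> F" "e \<notin> cut_arcs (G \<restriction> F) (restrict_family L F) Z"
    using assms(1) by (auto simp: unentered_def)
  then show ?thesis using assms(2-5) by (simp add: cut_arcs_restrict_iff)
qed

lemma ex_entering_arc:
  assumes "\<not> unentered F Z" "Z \<noteq> {}" "Z \<subseteq> F"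
  shows "\<exists>e \<in> arcs G. tail G e \<in> F \<and> tail G e \<notin> Z \<and> head G e \<in> Z \<and>
    (\<forall>F' \<in> L. F' \<subseteq> F \<longrightarrow> F' \<inter> Z \<noteq> {} \<longrightarrow> tail G e \<in> F' \<longrightarrow> head G e \<in> F')"
proof -
  have "\<exists>e. e \<in> cut_arcs (G \<restriction> F) (restrict_family L F) Z"
    using assms by (auto simp: unentered_def)
  then show ?thesis unfolding cut_arcs_restrict_iff[OF assms(3)] by blast
qed

lemma unentered_self: "F \<noteq> {} \<Longrightarrow> unentered F F"
  by (rule unenteredI) auto

text \<open>An arc entering \<open>F' \<inter> Z\<close> inside \<open>F'\<close> enters
  \<open>Z\<close>, so it leaves a member meeting \<open>Z\<close>. That member has the tail but not
  the head, both of which lie in \<open>F'\<close>, so laminarity pushes it inside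
  \<open>F'\<close>.\<close>

lemma unentered_restrict:
  assumes Z: "unentered F Z" and F': "F' \<in> L" "F' \<subseteq> F" "F' \<inter> Z \<noteq> {}"
  shows "unentered F' (F' \<inter> Z)"
proof (rule unenteredI)
  fix e assume e: "e \<in> arcs G" "tail G e \<in> F'" "tail G e \<notin> F' \<inter> Z" "head G e \<in> F' \<inter> Z"
  then have "tail G e \<in> F" "tail G e \<notin> Z" "head G e \<in> Z" using F'(2) by auto
  from unentered_arcD[OF Z e(1) this]
  obtain X where X: "X \<in> L" "X \<inter> Z \<noteq> {}" "tail G e \<in> X" "head G e \<notin> X" by blast
  have "X \<subseteq> F'" using laminarD[OF X(1) F'(1)] X e by blast
  then show "\<exists>X \<in> L. X \<subseteq> F' \<and> X \<inter> (F' \<inter> Z) \<noteq> {} \<and> tail G e \<in> X \<and> head G e \<notin> X"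
    using X by blast
qed (use F' in auto)

section \<open>Necessity of the cut condition\<close>

text \<open>
  The set \<open>entries B r F\<close> consists of the nodes where a walk in \<open>B\<close> from \<open>r\<close> can get
  into \<open>F\<close>; tightness means that there is at most one.
\<close>

definition entries :: "'b set \<Rightarrow> 'a \<Rightarrow> 'a set \<Rightarrow> 'a set" where
  "entries B r F = {v \<in> F. v = r \<or> (\<exists>e \<in> B. tail G e \<notin> F \<and> head G e = v)}"

text \<open>Descent on members that meet \<open>Z\<close> but have no entry in \<open>Z\<close>.
  Inside a minimal one, \<open>F'\<close>, some arc of \<open>B\<close> carries the generation into
  \<open>Z\<close>; as \<open>Z\<close> is unentered, this arc leaves a member \<open>X\<close>
  properly inside \<open>F'\<close>, and \<open>X\<close> is again such a member.\<close>

lemma not_unentered_if_no_entry: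
  assumes B: "B \<subseteq> arcs G" and gen: "generates G B r (verts G)"
    and single: "\<And>F x y. F \<in> L \<Longrightarrow> x \<in> entries B r F \<Longrightarrow> y \<in> entries B r F \<Longrightarrow> x = y"
    and F: "F \<in> L" and entry: "Z \<inter> entries B r F = {}"
  shows "\<not> unentered F Z"
proof
  assume Z: "unentered F Z"
  let ?P = "\<lambda>F'. F' \<subseteq> F \<and> F' \<inter> Z \<noteq> {} \<and> Z \<inter> entries B r F' = {}"
  have "?P F" using unenteredD[OF Z] entry by auto
  from ex_minimal_member[of F ?P, OF F this]
  obtain F' where F': "F' \<in> L" "F' \<subseteq> F" "F' \<inter> Z \<noteq> {}" "Z \<inter> entries B r F' = {}"
    and minimal: "\<And>X. X \<in> L \<Longrightarrow> ?P X \<Longrightarrow> X \<subseteq> F' \<Longrightarrow> X = F'" by metis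
  \<comment> \<open>\<open>T\<close> will be the part of \<open>F'\<close> reached from its entries
    before \<open>Z\<close> is touched.\<close>
  define E where "E = {(tail G e, head G e) | e. e \<in> B \<and> tail G e \<in> F' \<and> head G e \<in> F' - Z}"
  define T where "T = E\<^sup>* `` entries B r F'"
  have T: "T \<subseteq> F' - Z"
  proof
    fix v assume "v \<in> T"
    then obtain u where u: "u \<in> entries B r F'" "(u, v) \<in> E\<^sup>*" by (auto simp: T_def)
    from u(2) show "v \<in> F' - Z"
      by (induction rule: rtrancl_induct) (use u(1) F'(4) in \<open>auto simp: E_def entries_def\<close>)
  qed
  have "\<exists>e \<in> B. tail G e \<in> T \<and> head G e \<in> F' \<inter> Z"
  proof (rule ccontr)
    assume neg: "\<not> ?thesis"
    \<comment> \<open>Without an arc of \<open>B\<close> from \<open>T\<close> into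
      \<open>Z\<close>, this set is closed under \<open>B\<close>, yet it misses
      \<open>F' \<inter> Z\<close>.\<close>
    have "verts G \<subseteq> T \<union> - F'"
    proof (rule generatesD[OF gen])
      show "r \<in> T \<union> - F'" by (auto simp: T_def entries_def)
    next
      fix e assume e: "e \<in> B" "tail G e \<in> T \<union> - F'"
      show "head G e \<in> T \<union> - F'"
      proof (cases "head G e \<in> F'")
        case True
        show ?thesis
        proof (cases "tail G e \<in> F'")
          case False
          then have "head G e \<in> entries B r F'" using True e by (auto simp: entries_def)
          then show ?thesis by (auto simp: T_def)
        next
          case tl: True
          then have tT: "tail G e \<in> T" using e by auto
          then have "head G e \<notin> Z" using neg e True by auto
          then have "(tail G e, head G e) \<in> E" using True tl e unfolding E_def by blast
          then show ?thesis using tT unfolding T_def by (auto intro: rtrancl_into_rtrancl)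
        qed
      qed auto
    qed
    then show False using F'(1,3) T family by blast
  qed
  then obtain e where e: "e \<in> B" "tail G e \<in> T" "head G e \<in> F' \<inter> Z" by blast
  then have "e \<in> arcs G" "tail G e \<in> F'" "tail G e \<notin> Z" "head G e \<in> Z" using B T by auto
  note eA = this
  have "tail G e \<in> F" using eA F' by auto
  from unentered_arcD[OF Z eA(1) this eA(3,4)]
  obtain X where X: "X \<in> L" "X \<inter> Z \<noteq> {}" "tail G e \<in> X" "head G e \<notin> X" by blast
  have XF: "X \<subseteq> F'" "X \<noteq> F'" using laminarD[OF X(1) F'(1)] X e eA(2) by auto
  obtain u where u: "u \<in> entries B r F'" "(u, tail G e) \<in> E\<^sup>*" using e(2) by (auto simp: T_def)
  \<comment> \<open>The walk from \<open>u\<close> to the tail of \<open>e\<close> ends in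
    \<open>X\<close>. Either it steps into \<open>X\<close> from outside, or it starts there, and an
    entry of \<open>F'\<close> lying in \<open>X\<close> is an entry of \<open>X\<close>.\<close>
  have "\<exists>w \<in> T. w \<in> entries B r X"
  proof -
    have "v \<in> X \<Longrightarrow> \<exists>w \<in> T. w \<in> entries B r X" if "(u, v) \<in> E\<^sup>*" for v
      using that
    proof (induction rule: rtrancl_induct)
      case base
      then have "u \<in> entries B r X" using u(1) XF by (auto simp: entries_def)
      then show ?case using u(1) by (auto simp: T_def)
    next
      case (step y z)
      show ?case
      proof (cases "y \<in> X")
        case False
        then have "z \<in> entries B r X" using step by (auto simp: entries_def E_def)
        moreover have "z \<in> T" using u(1) step unfolding T_def by (auto intro: rtrancl_into_rtrancl)
        ultimately show ?thesis by blast
      qed (use step in auto)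
    qed
    then show ?thesis using u X by blast
  qed
  then have "Z \<inter> entries B r X = {}" using single[OF X(1)] T by blast
  then have "X = F'" using minimal[OF X(1)] X XF F' by blast
  then show False using XF by blast
qed

text \<open>By tightness the only possible entry of \<open>F\<close> is the root or the head of the
  single entering arc, and every unentered subset of \<open>F\<close> must contain an entry.\<close>

lemma tight_imp_unentered_intersect:
  assumes tight: "tight_arborescence G L B" and F: "F \<in> L"
    and Z: "unentered F Z1" "unentered F Z2"
  shows "Z1 \<inter> Z2 \<noteq> {}"
proof -
  let ?r = "arborescence_root G B"
  have arb: "arborescence G B" using tight by (simp add: tight_arborescence_def)
  then have B: "B \<subseteq> arcs G" by (simp add: arborescence_def)
  have fin: "finite {e \<in> B. P e}" for P using B finite_subset[OF _ finite_arcs] by auto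
  have ent: "entering_arcs (G\<lparr>arcs := B\<rparr>) X = {e \<in> B. tail G e \<notin> X \<and> head G e \<in> X}" for X
    by (auto simp: entering_arcs_def)
  have single: "x = y" if X: "X \<in> L" "x \<in> entries B ?r X" "y \<in> entries B ?r X" for X x y
  proof (cases "?r \<in> X")
    case True
    then have "{e \<in> B. tail G e \<notin> X \<and> head G e \<in> X} = {}"
      using tight X(1) fin by (auto simp: tight_arborescence_def ent)
    then show ?thesis using X by (auto simp: entries_def)
  next
    case False
    then obtain e e' where e: "e \<in> B" "tail G e \<notin> X" "head G e = x" "x \<in> X"
      "e' \<in> B" "tail G e' \<notin> X" "head G e' = y" "y \<in> X"
      using X by (auto simp: entries_def)
    have "card {e \<in> B. tail G e \<notin> X \<and> head G e \<in> X} \<le> Suc 0"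
      using tight X(1) by (auto simp: tight_arborescence_def ent)
    then have "e = e'" using e fin by (auto simp: card_le_Suc0_iff_eq)
    then show ?thesis using e by simp
  qed
  have "Z' \<inter> entries B ?r F \<noteq> {}" if "unentered F Z'" for Z'
  proof
    assume "Z' \<inter> entries B ?r F = {}"
    from not_unentered_if_no_entry[OF B arborescence_generates(2)[OF fin_digraph arb] single F this]
    show False using that by simp
  qed
  with Z obtain x y where "x \<in> Z1 \<inter> entries B ?r F" "y \<in> Z2 \<inter> entries B ?r F" by blast
  then show ?thesis using single[OF F] by blast
qed

end

section \<open>Sufficiency of the cut condition\<close>

locale uncut_digraph = laminar_digraph +
  assumes unentered_intersect:
    "F \<in> L \<Longrightarrow> unentered F Z1 \<Longrightarrow> unentered F Z2 \<Longrightarrow> Z1 \<inter> Z2 \<noteq> {}"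
begin

text \<open>The assumption is applied not only to \<open>F\<close> but to members below it: a member
  meeting both sets has two unentered traces, hence meets their intersection.\<close>

lemma unentered_Int:
  assumes F: "F \<in> L" and Z: "unentered F Z1" "unentered F Z2"
  shows "unentered F (Z1 \<inter> Z2)"
proof (rule unenteredI)
  show "Z1 \<inter> Z2 \<noteq> {}" using unentered_intersect[OF F Z] .
  show "Z1 \<inter> Z2 \<subseteq> F" using unenteredD(2)[OF Z(1)] by blast
  have one: "\<exists>X \<in> L. X \<subseteq> F \<and> X \<inter> (Z1 \<inter> Z2) \<noteq> {} \<and> tail G e \<in> X \<and> head G e \<notin> X"
    if e: "e \<in> arcs G" "tail G e \<in> F" "tail G e \<notin> Z1" "head G e \<in> Z1 \<inter> Z2"
      and Z: "unentered F Z1" "unentered F Z2" for e Z1 Z2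
  proof -
    have "head G e \<in> Z1" "head G e \<in> Z2" using e by auto
    from unentered_arcD[OF Z(1) e(1-3) this(1)]
    obtain X where X: "X \<in> L" "X \<subseteq> F" "X \<inter> Z1 \<noteq> {}" "tail G e \<in> X" "head G e \<notin> X" by blast
    show ?thesis
    proof (cases "X \<inter> Z2 = {}")
      case False
      have "(X \<inter> Z1) \<inter> (X \<inter> Z2) \<noteq> {}"
        using unentered_restrict Z X False by (intro unentered_intersect[OF X(1)]) auto
      then show ?thesis using X by blast
    next
      case True
      then have "tail G e \<notin> Z2" using X by blast
      from unentered_arcD[OF Z(2) e(1,2) this \<open>head G e \<in> Z2\<close>]
      obtain Y where Y: "Y \<in> L" "Y \<subseteq> F" "Y \<inter> Z2 \<noteq> {}" "tail G e \<in> Y" "head G e \<notin> Y" by blast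
      \<comment> \<open>\<open>X\<close> and \<open>Y\<close> share the tail of \<open>e\<close>,
        and \<open>Y\<close> meets \<open>Z2\<close> while \<open>X\<close> does not. So
        \<open>Y\<close> is the larger one and meets both sets.\<close>
      have "X \<subseteq> Y" using laminarD[OF X(1) Y(1)] X Y True by blast
      then have "Y \<inter> Z1 \<noteq> {}" using X by blast
      then have "(Y \<inter> Z1) \<inter> (Y \<inter> Z2) \<noteq> {}"
        using unentered_restrict[OF Z(1) Y(1,2)] unentered_restrict[OF Z(2) Y(1,2)] Y
        by (intro unentered_intersect[OF Y(1)]) auto
      then show ?thesis using Y by blast
    qed
  qed
  fix e assume e: "e \<in> arcs G" "tail G e \<in> F" "tail G e \<notin> Z1 \<inter> Z2" "head G e \<in> Z1 \<inter> Z2"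
  show "\<exists>X \<in> L. X \<subseteq> F \<and> X \<inter> (Z1 \<inter> Z2) \<noteq> {} \<and> tail G e \<in> X \<and> head G e \<notin> X"
  proof (cases "tail G e \<in> Z1")
    case True
    then have "tail G e \<notin> Z2" using e(3) by blast
    from one[OF e(1,2) this _ Z(2,1)] e(4) show ?thesis by (simp add: Int_commute)
  next
    case False
    from one[OF e(1,2) this e(4) Z] show ?thesis .
  qed
qed

text \<open>The nodes through which a tight arborescence may get into \<open>F\<close>. For empty
  \<open>F\<close> there is no unentered set and the value is \<open>UNIV\<close>, so uses of the
  core are confined to nonempty members.\<close>

definition core :: "'a set \<Rightarrow> 'a set" where
  "core F = \<Inter> {Z. unentered F Z}"

lemma core_least: "unentered F Z \<Longrightarrow> core F \<subseteq> Z"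
  by (auto simp: core_def)

lemma unentered_core:
  assumes F: "F \<in> L" "F \<noteq> {}"
  shows "unentered F (core F)"
proof -
  have "{Z. unentered F Z} \<subseteq> Pow F" by (auto simp: unentered_def)
  then have "finite {Z. unentered F Z}"
    using finite_member[OF F(1)] finite_subset by (simp add: finite_subset)
  moreover have "{Z. unentered F Z} \<noteq> {}" using unentered_self F by blast
  ultimately have "\<exists>Z0 \<in> {Z. unentered F Z}. \<forall>Z \<in> {Z. unentered F Z}. Z \<subseteq> Z0 \<longrightarrow> Z0 = Z"
    by (rule finite_has_minimal)
  then obtain Z0 where Z0: "unentered F Z0"
    and min: "\<And>Z. unentered F Z \<Longrightarrow> Z \<subseteq> Z0 \<Longrightarrow> Z0 = Z" by blast
  have "Z0 \<subseteq> Z" if "unentered F Z" for Z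
    using min[OF unentered_Int[OF F(1) Z0 that]] by blast
  then have "core F = Z0" using core_least[OF Z0] by (auto simp: core_def)
  then show ?thesis using Z0 by simp
qed

text \<open>Makes the choice of entry nodes consistent along a chain of members: a node in the core
  of a large member is in the core of every smaller member containing it.\<close>

lemma core_nested:
  assumes F: "F1 \<in> L" "F2 \<in> L" "F2 \<subseteq> F1" and ne: "core F1 \<inter> F2 \<noteq> {}"
  shows "core F1 \<inter> F2 = core F2"
proof -
  have c1: "unentered F1 (core F1)" and c2: "unentered F2 (core F2)"
    using unentered_core F ne by blast+
  \<comment> \<open>The core of \<open>F1\<close> with its part in \<open>F2\<close> replaced by the
    core of \<open>F2\<close>. Once it is unentered, minimality of \<open>core F1\<close> gives the
    nontrivial inclusion.\<close>
  let ?Z = "core F1 - F2 \<union> core F2"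
  have "unentered F1 ?Z"
  proof (rule unenteredI)
    show "?Z \<noteq> {}" "?Z \<subseteq> F1" using unenteredD[OF c2] unenteredD[OF c1] F by auto
  next
    fix e assume e: "e \<in> arcs G" "tail G e \<in> F1" "tail G e \<notin> ?Z" "head G e \<in> ?Z"
    have sub: "core F2 \<subseteq> core F1"
      using core_least[OF unentered_restrict[OF c1 F(2,3)]] ne by (auto simp: Int_commute)
    show "\<exists>X \<in> L. X \<subseteq> F1 \<and> X \<inter> ?Z \<noteq> {} \<and> tail G e \<in> X \<and> head G e \<notin> X"
    proof (cases "tail G e \<in> F2")
      case True
      show ?thesis
      proof (cases "head G e \<in> F2")
        case True
        then have "tail G e \<notin> core F2" "head G e \<in> core F2" using e by auto
        from unentered_arcD[OF c2 e(1) \<open>tail G e \<in> F2\<close> this] show ?thesis using F(3) by blast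
      next
        case False
        then show ?thesis using True F unenteredD[OF c2] by blast
      qed
    next
      case False
      then have "tail G e \<notin> core F1" "head G e \<in> core F1" using e sub by auto
      from unentered_arcD[OF c1 e(1,2) this]
      obtain X where X: "X \<in> L" "X \<subseteq> F1" "X \<inter> core F1 \<noteq> {}" "tail G e \<in> X" "head G e \<notin> X"
        by blast
      \<comment> \<open>If \<open>X\<close> meets \<open>core F1\<close> only within
        \<open>F2\<close>, then, having the tail outside \<open>F2\<close>, it contains all of
        \<open>F2\<close> and so the core of \<open>F2\<close>.\<close>
      have "X \<inter> ?Z \<noteq> {}"
        using laminarD[OF X(1) F(2)] X(3,4) False unenteredD[OF c2] by blast
      then show ?thesis using X by blast
    qed
  qed
  then have "core F1 \<subseteq> ?Z" by (rule core_least)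
  moreover have "core F2 \<subseteq> core F1 \<inter> F2"
    using core_least[OF unentered_restrict[OF c1 F(2,3)]] ne by (auto simp: Int_commute)
  ultimately show ?thesis by blast
qed

text \<open>
  The head of the new arc has to lie in the core of every member that the arc starts to explore.
  The arc is found inside a minimal partially explored member \<open>F\<close>: the set \<open>Z\<close> of admissible
  heads in \<open>F\<close> does not contain the core of \<open>F\<close>, hence is entered.
\<close>

lemma ex_extending_arc:
  assumes S: "S \<subseteq> verts G" "S \<noteq> {}" "S \<noteq> verts G"
    and S_core: "\<And>F. F \<in> L \<Longrightarrow> F \<inter> S \<noteq> {} \<Longrightarrow> core F \<inter> S \<noteq> {}"
  obtains e where "e \<in> arcs G" "tail G e \<in> S" "head G e \<notin> S"
    "\<And>F. F \<in> L \<Longrightarrow> head G e \<in> F \<Longrightarrow> tail G e \<notin> F \<Longrightarrow> F \<inter> S = {} \<and> head G e \<in> core F"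
proof -
  let ?P = "\<lambda>F. F \<inter> S \<noteq> {} \<and> F - S \<noteq> {}"
  have "?P (verts G)" using S by auto
  from ex_minimal_member[of "verts G" ?P, OF verts_in_family this]
  obtain F where F: "F \<in> L" "F \<inter> S \<noteq> {}" "F - S \<noteq> {}"
    and minimal: "\<And>X. X \<in> L \<Longrightarrow> ?P X \<Longrightarrow> X \<subseteq> F \<Longrightarrow> X = F" by metis
  define Z where "Z = {v \<in> F - S. \<forall>X \<in> L. v \<in> X \<longrightarrow> X \<inter> S = {} \<longrightarrow> v \<in> core X}"
  have below: "X \<subseteq> F" if "X \<in> L" "X \<inter> S = {}" "v \<in> X" "v \<in> F" for X v
    using laminarD[OF that(1) F(1)] that F by blast
  \<comment> \<open>In a maximal unexplored member the constraints of smaller members come for free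
    by \<open>core_nested\<close>.\<close>
  have maximal_core: "Z \<inter> M = core M"
    if M: "M \<in> L" "M \<subseteq> F" "M \<inter> S = {}"
      and max: "\<And>X. X \<in> L \<Longrightarrow> X \<inter> S = {} \<Longrightarrow> M \<subseteq> X \<Longrightarrow> X = M" and ne: "M \<noteq> {}" for M
  proof
    show "Z \<inter> M \<subseteq> core M" using M by (auto simp: Z_def)
    have "core M \<subseteq> M" using unentered_core[OF M(1) ne] unenteredD by blast
    show "core M \<subseteq> Z \<inter> M"
    proof
      fix v assume v: "v \<in> core M"
      have "v \<in> core X" if X: "X \<in> L" "v \<in> X" "X \<inter> S = {}" for X
      proof -
        have "X \<subseteq> M" using laminarD[OF X(1) M(1)] max[OF X(1,3)] v \<open>core M \<subseteq> M\<close> X by blast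
        then show ?thesis using core_nested[OF M(1) X(1)] v X by blast
      qed
      then show "v \<in> Z \<inter> M" using v \<open>core M \<subseteq> M\<close> M by (auto simp: Z_def)
    qed
  qed
  have maximal_above: "\<exists>M \<in> L. X \<subseteq> M \<and> M \<subseteq> F \<and> Z \<inter> M = core M \<and> unentered M (core M)"
    if X: "X \<in> L" "X \<inter> S = {}" "v \<in> X" "v \<in> F" for X v
  proof -
    obtain M where M: "M \<in> L" "M \<inter> S = {}" "X \<subseteq> M"
      and max: "\<And>Y. Y \<in> L \<Longrightarrow> Y \<inter> S = {} \<Longrightarrow> M \<subseteq> Y \<Longrightarrow> Y = M"
      using ex_maximal_member[of X "\<lambda>X. X \<inter> S = {}", OF X(1,2)] by metis
    moreover have "M \<subseteq> F" using below[OF M(1,2)] M X by blast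
    moreover have "M \<noteq> {}" using M X by blast
    ultimately show ?thesis using maximal_core[of M] unentered_core[of M] by blast
  qed
  have "Z \<noteq> {}"
  proof -
    obtain v where v: "v \<in> F - S" using F by blast
    show ?thesis
    proof (cases "v \<in> Z")
      case False
      then obtain X where "X \<in> L" "X \<inter> S = {}" "v \<in> X" using v by (auto simp: Z_def)
      from maximal_above[OF this] v obtain M where "Z \<inter> M = core M" "unentered M (core M)" by blast
      then show ?thesis using unenteredD by blast
    qed blast
  qed
  have ZF: "Z \<subseteq> F" "Z \<inter> S = {}" by (auto simp: Z_def)
  have "\<not> core F \<subseteq> Z" using S_core[OF F(1,2)] ZF by blast
  then have "\<not> unentered F Z" using core_least by blast
  then obtain e where e: "e \<in> arcs G" "tail G e \<in> F" "tail G e \<notin> Z" "head G e \<in> Z"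
    and no_leave: "\<And>X. X \<in> L \<Longrightarrow> X \<subseteq> F \<Longrightarrow> X \<inter> Z \<noteq> {} \<Longrightarrow> tail G e \<in> X \<Longrightarrow> head G e \<in> X"
    using ex_entering_arc[OF _ \<open>Z \<noteq> {}\<close> ZF(1)] by metis
  \<comment> \<open>Otherwise the tail lies in a maximal unexplored \<open>M\<close>. The arc cannot
    leave \<open>M\<close>, so it enters \<open>core M\<close> inside \<open>M\<close> and thus
    leaves some \<open>Y\<close> meeting \<open>core M\<close>, hence \<open>Z\<close>; no such
    member exists.\<close>
  have "tail G e \<in> S"
  proof (rule ccontr)
    assume "tail G e \<notin> S"
    then obtain X where "X \<in> L" "X \<inter> S = {}" "tail G e \<in> X"
      using e by (auto simp: Z_def)
    from maximal_above[OF this e(2)] this obtain M where M: "M \<in> L" "M \<subseteq> F" "Z \<inter> M = core M"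
      "unentered M (core M)" "tail G e \<in> M" by blast
    then have "head G e \<in> core M" using no_leave[OF M(1,2)] e unenteredD[OF M(4)] by blast
    moreover have "tail G e \<notin> core M" using M(3) e(3) by blast
    ultimately obtain Y
      where Y: "Y \<in> L" "Y \<subseteq> M" "Y \<inter> core M \<noteq> {}" "tail G e \<in> Y" "head G e \<notin> Y"
      using unentered_arcD[OF M(4) e(1) M(5)] by blast
    have "Y \<subseteq> F" "Y \<inter> Z \<noteq> {}" using Y M by blast+
    then show False using no_leave[OF Y(1)] Y(4,5) by blast
  qed
  moreover have "X \<inter> S = {} \<and> head G e \<in> core X"
    if X: "X \<in> L" "head G e \<in> X" "tail G e \<notin> X" for X
  proof -
    \<comment> \<open>\<open>F\<close> contains both ends of \<open>e\<close>, so \<open>X\<close>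
      is properly inside \<open>F\<close>; as the head is unexplored, minimality of \<open>F\<close>
      keeps \<open>X\<close> disjoint from \<open>S\<close>.\<close>
    have "X \<subseteq> F" "X \<noteq> F" using laminarD[OF X(1) F(1)] X e ZF by blast+
    then have "X \<inter> S = {}" using minimal[OF X(1)] X e ZF by blast
    then show ?thesis using e X by (auto simp: Z_def)
  qed
  ultimately show thesis using that e ZF by blast
qed

section \<open>Greedy growth of a tight arborescence\<close>

definition partial_tight :: "'a \<Rightarrow> 'a set \<Rightarrow> 'b set \<Rightarrow> bool" where
  "partial_tight r S B \<longleftrightarrow> r \<in> S \<and> S \<subseteq> verts G \<and> B \<subseteq> arcs G \<and>
     (\<forall>e \<in> B. tail G e \<in> S \<and> head G e \<in> S \<and> head G e \<noteq> r) \<and>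
     inj_on (head G) B \<and> generates G B r S \<and>
     (\<exists>h :: 'a \<Rightarrow> nat. \<forall>e \<in> B. h (tail G e) < h (head G e)) \<and>
     (\<forall>F \<in> L. F \<inter> S \<noteq> {} \<longrightarrow> core F \<inter> S \<noteq> {}) \<and>
     (\<forall>F \<in> L. r \<in> F \<longrightarrow> entering_arcs (G\<lparr>arcs := B\<rparr>) F = {}) \<and>
     (\<forall>F \<in> L. card (entering_arcs (G\<lparr>arcs := B\<rparr>) F) \<le> 1)"

text \<open>By nesting, a node in the core of the whole node set is in the core of every member
  containing it.\<close>

lemma partial_tight_start:
  assumes "r \<in> core (verts G)" "verts G \<noteq> {}"
  shows "partial_tight r {r} {}"
proof -
  have "r \<in> verts G" using assms unenteredD[OF unentered_core[OF verts_in_family]] by blast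
  moreover have "r \<in> core F" if "F \<in> L" "r \<in> F" for F
    using core_nested[OF verts_in_family that(1)] that assms(1) family by blast
  ultimately show ?thesis
    by (auto simp: partial_tight_def generates_def entering_arcs_def)
qed

lemma partial_tight_extend:
  assumes P: "partial_tight r S B" and S: "S \<noteq> verts G"
  shows "\<exists>v B'. v \<notin> S \<and> partial_tight r (insert v S) B'"
proof -
  have rS: "r \<in> S" and SV: "S \<subseteq> verts G" and BA: "B \<subseteq> arcs G"
    and BS: "\<And>e. e \<in> B \<Longrightarrow> tail G e \<in> S" "\<And>e. e \<in> B \<Longrightarrow> head G e \<in> S"
      "\<And>e. e \<in> B \<Longrightarrow> head G e \<noteq> r"
    and inj: "inj_on (head G) B" and gen: "generates G B r S"
    and core: "\<And>F. F \<in> L \<Longrightarrow> F \<inter> S \<noteq> {} \<Longrightarrow> core F \<inter> S \<noteq> {}"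
    and rootF: "\<And>F. F \<in> L \<Longrightarrow> r \<in> F \<Longrightarrow> entering_arcs (G\<lparr>arcs := B\<rparr>) F = {}"
    and card: "\<And>F. F \<in> L \<Longrightarrow> card (entering_arcs (G\<lparr>arcs := B\<rparr>) F) \<le> 1"
    using P by (auto simp: partial_tight_def)
  have "\<exists>h :: 'a \<Rightarrow> nat. \<forall>e \<in> B. h (tail G e) < h (head G e)"
    using P by (simp add: partial_tight_def)
  then obtain h :: "'a \<Rightarrow> nat" where h: "\<And>e. e \<in> B \<Longrightarrow> h (tail G e) < h (head G e)"
    by blast
  have "S \<noteq> {}" using rS by blast
  from ex_extending_arc[OF SV this S core] obtain e
    where e: "e \<in> arcs G" "tail G e \<in> S" "head G e \<notin> S"
      and enter: "\<And>F. F \<in> L \<Longrightarrow> head G e \<in> F \<Longrightarrow> tail G e \<notin> F \<Longrightarrow>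
        F \<inter> S = {} \<and> head G e \<in> core F" by metis
  let ?v = "head G e" and ?B = "insert e B"
  let ?S = "insert ?v S"
  have eB: "e \<notin> B" using BS e by blast
  \<comment> \<open>A member that \<open>e\<close> enters is disjoint from \<open>S\<close>, so no
    arc of \<open>B\<close> enters it and \<open>e\<close> is its only entering arc.\<close>
  have ent: "entering_arcs (G\<lparr>arcs := ?B\<rparr>) F =
      (if ?v \<in> F \<and> tail G e \<notin> F then {e} else entering_arcs (G\<lparr>arcs := B\<rparr>) F)"
    if "F \<in> L" for F
    using enter[OF that] BS by (auto simp: entering_arcs_def)
  have "generates G ?B r ?S"
    unfolding generates_def
  proof (intro allI impI)
    fix X assume "r \<in> X" "\<forall>e \<in> ?B. tail G e \<in> X \<longrightarrow> head G e \<in> X"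
    then show "?S \<subseteq> X" using generatesD[OF gen, of X] e by auto
  qed
  moreover have "inj_on (head G) ?B" using inj BS e by auto
  moreover have "\<exists>h :: 'a \<Rightarrow> nat. \<forall>e' \<in> ?B. h (tail G e') < h (head G e')"
  \<comment> \<open>No arc of \<open>B\<close> touches the new node, so its height can be set
    freely, one above the tail of \<open>e\<close>.\<close>
  proof (intro exI[of _ "h(?v := Suc (h (tail G e)))"] ballI)
    fix e' assume e': "e' \<in> ?B"
    have "tail G e' \<noteq> ?v" "e' \<noteq> e \<Longrightarrow> head G e' \<noteq> ?v" using e' e(2,3) BS(1,2)[of e'] by auto
    then show "(h(?v := Suc (h (tail G e)))) (tail G e') <
        (h(?v := Suc (h (tail G e)))) (head G e')"
      using h e' by (cases "e' = e") auto
  qed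
  moreover have "core F \<inter> ?S \<noteq> {}" if F: "F \<in> L" "F \<inter> ?S \<noteq> {}" for F
    using core[OF F(1)] enter[OF F(1)] F(2) e(2) by (cases "F \<inter> S = {}") auto
  moreover have "entering_arcs (G\<lparr>arcs := ?B\<rparr>) F = {}" if "F \<in> L" "r \<in> F" for F
    using enter[OF that(1)] rootF[OF that] rS that by (auto simp: ent)
  moreover have "card (entering_arcs (G\<lparr>arcs := ?B\<rparr>) F) \<le> 1" if "F \<in> L" for F
    using card[OF that] by (auto simp: ent[OF that])
  moreover have "?S \<subseteq> verts G" "?B \<subseteq> arcs G" "r \<in> ?S" using SV BA e rS by auto
  moreover have "\<forall>e' \<in> ?B. tail G e' \<in> ?S \<and> head G e' \<in> ?S \<and> head G e' \<noteq> r"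
    using e BS rS by auto
  ultimately have "partial_tight r ?S ?B" unfolding partial_tight_def by blast
  then show ?thesis using e by blast
qed

lemma ex_tight_arborescence:
  assumes "verts G \<noteq> {}"
  shows "\<exists>B. tight_arborescence G L B"
proof -
  obtain r where r: "r \<in> core (verts G)"
    using unenteredD(1)[OF unentered_core[OF verts_in_family assms]] by blast
  let ?\<S> = "{S. \<exists>B. partial_tight r S B}"
  have "finite ?\<S>"
    by (rule finite_subset[of _ "Pow (verts G)"]) (auto simp: partial_tight_def)
  moreover have "{r} \<in> ?\<S>" using partial_tight_start[OF r assms] by blast
  ultimately have "\<exists>S \<in> ?\<S>. \<forall>S' \<in> ?\<S>. S \<subseteq> S' \<longrightarrow> S = S'"
    by (intro finite_has_maximal) auto
  then obtain S B where P: "partial_tight r S B"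
    and max: "\<forall>S' \<in> ?\<S>. S \<subseteq> S' \<longrightarrow> S = S'" by blast
  have S: "S = verts G"
  proof (rule ccontr)
    assume "S \<noteq> verts G"
    from partial_tight_extend[OF P this] obtain v B' where
      v: "v \<notin> S" "partial_tight r (insert v S) B'" by blast
    then have "S = insert v S" using max by blast
    then show False using v(1) by blast
  qed
  have "\<exists>h :: 'a \<Rightarrow> nat. \<forall>e \<in> B. h (tail G e) < h (head G e)"
    using P by (simp add: partial_tight_def)
  then obtain h :: "'a \<Rightarrow> nat" where h: "\<And>e. e \<in> B \<Longrightarrow> h (tail G e) < h (head G e)"
    by blast
  have "B \<subseteq> arcs G" "r \<in> verts G" "inj_on (head G) B" "\<And>e. e \<in> B \<Longrightarrow> head G e \<noteq> r"
    "generates G B r (verts G)"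
    using P S by (auto simp: partial_tight_def)
  note arborescenceI[where h = h, OF fin_digraph this h]
  then have "tight_arborescence G L B"
    using P by (auto simp: tight_arborescence_def partial_tight_def)
  then show ?thesis ..
qed

end

section \<open>Blocking sets and double cuts\<close>

context laminar_digraph
begin

lemma laminar_digraph_remove_arcs: "laminar_digraph (G\<lparr>arcs := arcs G - H\<rparr>) L"
  using fin_digraph_arcs_subset[OF fin_digraph, of "arcs G - H"] family laminar verts_in_family
  by (auto simp: laminar_digraph_def laminar_digraph_axioms_def)

text \<open>Nonemptiness matters: on no nodes there is no arborescence, while the right-hand side
  holds vacuously.\<close>

lemma tight_iff_unentered_intersect:
  assumes "verts G \<noteq> {}"
  shows "(\<exists>B. tight_arborescence G L B) \<longleftrightarrow>
    (\<forall>F \<in> L. \<forall>Z1 Z2. unentered F Z1 \<longrightarrow> unentered F Z2 \<longrightarrow> Z1 \<inter> Z2 \<noteq> {})" (is "_ \<longleftrightarrow> ?C")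
proof
  assume ?C
  then interpret uncut_digraph G L by unfold_locales blast
  show "\<exists>B. tight_arborescence G L B" using ex_tight_arborescence[OF assms] .
qed (use tight_imp_unentered_intersect in blast)

lemma empty_double_cut_iff:
  "double_cut G L {} \<longleftrightarrow>
    (\<exists>F \<in> L. \<exists>Z1 Z2. unentered F Z1 \<and> unentered F Z2 \<and> Z1 \<inter> Z2 = {})"
  unfolding double_cut_def unentered_def by (intro bex_cong refl ex_cong1) auto

lemma tight_iff_no_empty_double_cut:
  assumes "verts G \<noteq> {}"
  shows "(\<exists>B. tight_arborescence G L B) \<longleftrightarrow> \<not> double_cut G L {}"
  unfolding tight_iff_unentered_intersect[OF assms] empty_double_cut_iff by simp

text \<open>The sets of leaving arcs shrink too, but only by arcs of \<open>H\<close>, which are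
  gone from the entering arcs as well.\<close>

lemma cut_arcs_remove_arcs:
  "cut_arcs (G\<lparr>arcs := arcs G - H\<rparr> \<restriction> F) K Z = cut_arcs (G \<restriction> F) K Z - H"
  by (auto simp: cut_arcs_def entering_arcs_def leaving_arcs_def)

lemma empty_double_cut_remove_arcs_iff:
  "double_cut (G\<lparr>arcs := arcs G - H\<rparr>) L {} \<longleftrightarrow> (\<exists>C \<subseteq> H. double_cut G L C)"
proof -
  have "{} = (A - H) \<union> (B - H) \<longleftrightarrow> (\<exists>C \<subseteq> H. C = A \<union> B)" for A B by blast
  then show ?thesis unfolding double_cut_def cut_arcs_remove_arcs by metis
qed

lemma blocks_iff:
  assumes "verts G \<noteq> {}"
  shows "\<not> (\<exists>B. tight_arborescence (G\<lparr>arcs := arcs G - H\<rparr>) L B) \<longleftrightarrow>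
    (\<exists>C \<subseteq> H. double_cut G L C)"
proof -
  interpret GH: laminar_digraph "G\<lparr>arcs := arcs G - H\<rparr>" L by (rule laminar_digraph_remove_arcs)
  show ?thesis
    using GH.tight_iff_no_empty_double_cut assms empty_double_cut_remove_arcs_iff by auto
qed

lemma double_cut_subset_arcs: "double_cut G L C \<Longrightarrow> C \<subseteq> arcs G"
  by (auto simp: double_cut_def cut_arcs_def entering_arcs_def)

text \<open>Blocking sets are exactly the arc sets containing a double cut, so the smallest size is
  attained by double cuts.\<close>

lemma blocking_number_eq:
  assumes "verts G \<noteq> {}"
  shows "blocking_number G L = Inf {enat (card C) | C. double_cut G L C}"
proof (rule antisym)
  show "blocking_number G L \<le> Inf {enat (card C) | C. double_cut G L C}"
    unfolding blocking_number_def blocks_iff[OF assms]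
    by (rule Inf_superset_mono) (use double_cut_subset_arcs in blast)
  show "Inf {enat (card C) | C. double_cut G L C} \<le> blocking_number G L"
    unfolding blocking_number_def blocks_iff[OF assms]
  proof (rule Inf_mono)
    fix b assume "b \<in> {enat (card H) | H. H \<subseteq> arcs G \<and> (\<exists>C \<subseteq> H. double_cut G L C)}"
    then obtain H C where "b = enat (card H)" "H \<subseteq> arcs G" "C \<subseteq> H" "double_cut G L C" by blast
    moreover from this have "card C \<le> card H"
      by (meson card_mono finite_arcs finite_subset)
    ultimately show "\<exists>a \<in> {enat (card C) | C. double_cut G L C}. a \<le> b" by auto
  qed
qed

lemma double_cut_value_eq:
  "(INF F \<in> L. double_cut_value G L F) = Inf {enat (card C) | C. double_cut G L C}"
proof -
  let ?M = "\<lambda>F. cut_arcs (G \<restriction> F) (restrict_family L F)"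
  have card: "cut_size (G \<restriction> F) (restrict_family L F) Z1 +
      cut_size (G \<restriction> F) (restrict_family L F) Z2 = card (?M F Z1 \<union> ?M F Z2)"
    if "Z1 \<inter> Z2 = {}" for F Z1 Z2
  proof -
    have "finite (?M F Z)" for Z
      by (rule finite_subset[OF _ finite_arcs]) (auto simp: cut_arcs_def entering_arcs_def)
    \<comment> \<open>Arcs of the two cuts have their heads in disjoint sets, so the sum of sizes is
      the size of the union.\<close>
    moreover have "?M F Z1 \<inter> ?M F Z2 = {}"
      using that by (auto simp: cut_arcs_def entering_arcs_def)
    ultimately show ?thesis by (simp add: cut_size_def card_Un_disjoint)
  qed
  let ?V = "\<lambda>F. {enat (card (?M F Z1 \<union> ?M F Z2)) | Z1 Z2.
     Z1 \<noteq> {} \<and> Z2 \<noteq> {} \<and> Z1 \<subseteq> F \<and> Z2 \<subseteq> F \<and> Z1 \<inter> Z2 = {}}"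
  have value_eq: "double_cut_value G L F = Inf (?V F)" for F
    unfolding double_cut_value_def
    by (intro arg_cong[where f = Inf] Collect_cong ex_cong1) (auto simp: card)
  have "double_cut G L (?M F Z1 \<union> ?M F Z2)"
    if "F \<in> L" "Z1 \<noteq> {}" "Z2 \<noteq> {}" "Z1 \<subseteq> F" "Z2 \<subseteq> F" "Z1 \<inter> Z2 = {}" for F Z1 Z2
    unfolding double_cut_def by (intro bexI[of _ F] exI[of _ Z1] exI[of _ Z2] conjI refl that)
  then have V: "F \<in> L \<Longrightarrow> ?V F \<subseteq> {enat (card C) | C. double_cut G L C}" for F by blast
  have V': "\<exists>F \<in> L. enat (card C) \<in> ?V F" if "double_cut G L C" for C
  proof -
    from that obtain F Z1 Z2 where *: "F \<in> L" "C = ?M F Z1 \<union> ?M F Z2"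
      "Z1 \<noteq> {}" "Z2 \<noteq> {}" "Z1 \<subseteq> F" "Z2 \<subseteq> F" "Z1 \<inter> Z2 = {}"
      unfolding double_cut_def by (elim bexE exE conjE)
    have "enat (card C) \<in> ?V F"
      unfolding *(2) mem_Collect_eq
      by (intro exI[of _ Z1] exI[of _ Z2] conjI refl *(3-))
    with *(1) show ?thesis by (rule bexI[rotated])
  qed
  show ?thesis
    unfolding value_eq
  proof (rule antisym)
    show "Inf {enat (card C) | C. double_cut G L C} \<le> (INF F \<in> L. Inf (?V F))"
      using V by (intro INF_greatest Inf_superset_mono)
    show "(INF F \<in> L. Inf (?V F)) \<le> Inf {enat (card C) | C. double_cut G L C}"
    proof (rule Inf_greatest)
      fix b assume "b \<in> {enat (card C) | C. double_cut G L C}"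
      then obtain F where "F \<in> L" "b \<in> ?V F" using V' by blast
      then show "(INF F \<in> L. Inf (?V F)) \<le> b" by (meson INF_lower2 Inf_lower)
    qed
  qed
qed

end

theorem theorem2:
  fixes G :: "('a, 'b) pre_digraph" and L :: "'a set set"
  assumes "fin_digraph G"
    and "verts G \<noteq> {}"
    and "L \<subseteq> Pow (verts G)"
    and "laminar L"
    and "verts G \<in> L"
  shows "blocking_number G L = (INF F \<in> L. double_cut_value G L F) \<and>
         blocking_number G L = Inf {enat (card C) | C. double_cut G L C}"
proof -
  interpret laminar_digraph G L
    using assms by (simp add: laminar_digraph_def laminar_digraph_axioms_def)
  show ?thesis using blocking_number_eq[OF assms(2)] double_cut_value_eq by simp
qed

end
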